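(* Let $\delta\ge 1$ and $\rho(r)=r+\sqrt{1+r^2}$. There is a constant $C(B,\delta)>0$, depending only on $B>0$ and $\delta$ and monotonically increasing in $B$, such that for every compact interval $[a,b]$ with $a<b$, all $C_G,A>0$, every $f\in G^\delta([a,b],C_G,A)$ and every $m\in\mathbb{N}$ with $m\ge 3$, with $B=A(b-a)/2$, \[ \min_{q\in\mathcal{P}_m}\|f-q\|_{C([a,b])}\le C(B,\delta)\,C_G\,\rho(1/B)^{-m^{1/\delta}/e^2}. \]
   Context: $\mathcal{P}_m$ is the space of univariate polynomials of degree at most $m$, and $\|\cdot\|_{C([a,b])}$ is the maximum norm on $[a,b]$. For $\delta\ge 1$ and $C_G,A>0$, $f\in G^\delta([a,b],C_G,A)$ means that $f\in C^\infty([a,b])$ and $|f^{(k)}(x)|\le C_G A^{k}(k!)^\delta$ for all $x\in[a,b]$ and all $k\in\mathbb{N}_0$. Here $e$ is Euler's number. *)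

theory Defs
  imports "HOL-Analysis.Analysis" "HOL-Computational_Algebra.Polynomial"
begin

text \<open>Derivatives are taken within the interval, hence are one-sided at \<open>a\<close> and \<open>b\<close>.
  The values of \<open>deriv_within a b k f\<close> outside \<open>[a,b]\<close> carry no meaning, and never influence
  the values inside.\<close>

primrec deriv_within :: "real \<Rightarrow> real \<Rightarrow> nat \<Rightarrow> (real \<Rightarrow> real) \<Rightarrow> real \<Rightarrow> real" where
  "deriv_within a b 0 f = f"
| "deriv_within a b (Suc k) f =
     (\<lambda>x. vector_derivative (deriv_within a b k f) (at x within {a..b}))"

definition smooth_on_Icc :: "real \<Rightarrow> real \<Rightarrow> (real \<Rightarrow> real) \<Rightarrow> bool" where
  "smooth_on_Icc a b f \<longleftrightarrow> (\<forall>k. deriv_within a b k f differentiable_on {a..b})"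

definition gevrey :: "real \<Rightarrow> real \<Rightarrow> real \<Rightarrow> real \<Rightarrow> real \<Rightarrow> (real \<Rightarrow> real) set" where
  "gevrey \<delta> a b C\<^sub>G A = {f. smooth_on_Icc a b f \<and>
     (\<forall>k. \<forall>x\<in>{a..b}. \<bar>deriv_within a b k f x\<bar> \<le> C\<^sub>G * A ^ k * fact k powr \<delta>)}"

definition polys :: "nat \<Rightarrow> real poly set" where
  "polys m = {q. degree q \<le> m}"

text \<open>For continuous \<open>g\<close> and \<open>a \<le> b\<close> the supremum is attained, so it is the maximum norm.\<close>

definition maxnorm :: "real \<Rightarrow> real \<Rightarrow> (real \<Rightarrow> real) \<Rightarrow> real" where
  "maxnorm a b g = (SUP x\<in>{a..b}. \<bar>g x\<bar>)"

definition rho :: "real \<Rightarrow> real" where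
  "rho r = r + sqrt (1 + r\<^sup>2)"

end

theory Submission
  imports Defs
begin

text \<open>Integrating by parts \<open>k\<close> times bounds the \<open>n\<close>-th Chebyshev coefficient of a polynomial \<open>g\<close> on
  \<open>[-1,1]\<close> by \<open>2 M / (n (n - 1) \<cdots> (n - k + 1))\<close>, where \<open>M\<close> bounds the \<open>k\<close>-th derivative; the tails of
  these bounds telescope. Approximating the \<open>k\<close>-th derivative of \<open>f\<close> by polynomials and integrating
  back carries the estimate over to smooth \<open>f\<close>. For Gevrey functions and \<open>L = \<lfloor>m powr (1/\<delta>)\<rfloor>\<close> it reads,
  up to powers of \<open>L + 1\<close>, \<open>const * B ^ j / (L choose j)\<close> for every \<open>j \<le> L\<close>, because \<open>(L - i) powr \<delta> \<le> m - i\<close>. By the binomial theorem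
  some \<open>j\<close> makes this at most \<open>const * (L + 1) * (1 + 1/B) powr (- L)\<close>, and \<open>\<rho>(1/B) \<le> (1 + 1/B)\<^sup>2\<close> together with
  \<open>m powr (1/\<delta>) \<le> 2 L\<close> and \<open>e\<^sup>2 > 4\<close> leaves room to absorb the powers of \<open>L\<close>.\<close>

subsection \<open>Chebyshev coefficients\<close>

fun chebT :: "nat \<Rightarrow> real poly" where
  "chebT 0 = 1"
| "chebT (Suc 0) = [:0, 1:]"
| "chebT (Suc (Suc n)) = [:0, 2:] * chebT (Suc n) - chebT n"

lemma poly_chebT_cos: "poly (chebT n) (cos t) = cos (real n * t)"
proof (induction n rule: chebT.induct)
  case (3 n)
  have "cos (real (Suc n) * t + t) + cos (real (Suc n) * t - t) = 2 * cos t * cos (real (Suc n) * t)"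
    by (simp add: cos_add cos_diff)
  then show ?case using 3 by (simp add: algebra_simps)
qed auto

lemma abs_poly_chebT_le_1:
  assumes "\<bar>y\<bar> \<le> 1" shows "\<bar>poly (chebT n) y\<bar> \<le> 1"
  using poly_chebT_cos[of n "arccos y"] assms by (simp add: abs_le_iff)

lemma degree_chebT_le: "degree (chebT n) \<le> n"
proof (induction n rule: chebT.induct)
  case (3 n)
  have "degree ([:0, 2:] * chebT (Suc n)) \<le> Suc (Suc n)"
    by (rule order_trans[OF degree_mult_le]) (use 3 in auto)
  then show ?case using 3 by (auto intro: degree_diff_le)
qed auto

lemma coeff_chebT_pos: "coeff (chebT n) n > 0"
proof (induction n rule: chebT.induct)
  case (3 n)
  have "coeff (chebT n) (Suc (Suc n)) = 0"
    by (rule coeff_eq_0) (use degree_chebT_le[of n] in auto)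
  then show ?case using 3 by (simp add: coeff_pCons)
qed auto

text \<open>Since \<open>chebT n\<close> has exact degree \<open>n\<close>, the top coefficient of
  \<open>p\<close> can be eliminated by a multiple of \<open>chebT m\<close>, which lowers the
  degree.\<close>

lemma ex_chebT_sum:
  assumes "degree p \<le> m"
  shows "\<exists>c. p = (\<Sum>n\<le>m. smult (c n) (chebT n))"
  using assms
proof (induction m arbitrary: p)
  case 0
  then obtain a where "p = [:a:]" using degree_0_id by (metis le_zero_eq)
  then show ?case by (intro exI[of _ "\<lambda>_. a"]) simp
next
  case (Suc m)
  define a where "a = coeff p (Suc m) / coeff (chebT (Suc m)) (Suc m)"
  let ?q = "p - smult a (chebT (Suc m))"
  have "degree ?q \<le> Suc m"
    using Suc.prems degree_chebT_le[of "Suc m"] degree_smult_le[of a "chebT (Suc m)"]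
    by (intro degree_diff_le) auto
  moreover have "coeff ?q (Suc m) = 0"
    using coeff_chebT_pos[of "Suc m"] by (simp add: a_def)
  ultimately have "degree ?q \<le> m"
    by (metis degree_0 le_SucE leading_coeff_0_iff zero_le)
  from Suc.IH[OF this] obtain c where c: "?q = (\<Sum>n\<le>m. smult (c n) (chebT n))" by blast
  have "(\<Sum>n\<le>Suc m. smult ((c(Suc m := a)) n) (chebT n)) = (\<Sum>n\<le>m. smult (c n) (chebT n)) + smult a (chebT (Suc m))"
    by simp
  then show ?case using c by (metis diff_add_cancel)
qed

text \<open>The Chebyshev coefficient after the substitution \<open>y = cos t\<close>. The
  normalisation \<open>2 / pi\<close> is kept for all \<open>n\<close>, so at \<open>n = 0\<close>
  this is twice the coefficient of \<open>chebT 0\<close>.\<close>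

definition cheb_coeff :: "nat \<Rightarrow> (real \<Rightarrow> real) \<Rightarrow> real" where
  "cheb_coeff n u = 2 / pi * integral {0..pi} (\<lambda>t. u (cos t) * cos (real n * t))"

lemma abs_cheb_coeff_le:
  assumes "\<And>y. \<bar>y\<bar> \<le> 1 \<Longrightarrow> \<bar>u y\<bar> \<le> M" "continuous_on UNIV u"
  shows "\<bar>cheb_coeff n u\<bar> \<le> 2 * M"
proof -
  have "norm (integral {0..pi} (\<lambda>t. u (cos t) * cos (real n * t))) \<le> M * (pi - 0)"
  proof (rule integral_bound)
    show "continuous_on {0..pi} (\<lambda>t. u (cos t) * cos (real n * t))"
      by (intro continuous_intros continuous_on_compose2[OF assms(2)]) auto
    fix t :: real
    have "\<bar>u (cos t)\<bar> * \<bar>cos (real n * t)\<bar> \<le> M * 1"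
      by (intro mult_mono) (auto intro!: assms(1) order_trans[OF abs_ge_zero assms(1)[of 0]])
    then show "norm (u (cos t) * cos (real n * t)) \<le> M" by (simp add: abs_mult)
  qed auto
  then show ?thesis
    by (simp add: cheb_coeff_def abs_mult field_simps)
qed

text \<open>Integration by parts: the boundary terms vanish because \<open>sin (n * t)\<close> is
  zero at \<open>0\<close> and \<open>pi\<close>, and \<open>sin (n * t) * sin t\<close> is half the
  difference of the cosines with frequencies \<open>n - 1\<close> and \<open>n + 1\<close>.\<close>

lemma cheb_coeff_pderiv:
  assumes "n \<ge> 1"
  shows "cheb_coeff n (poly g) =
    (cheb_coeff (n - 1) (poly (pderiv g)) - cheb_coeff (n + 1) (poly (pderiv g))) / (2 * real n)"
proof -
  let ?d = "poly (pderiv g)"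
  let ?I = "\<lambda>k u. integral {0..pi} (\<lambda>t. u (cos t) * cos (real k * t))"
  have int: "(\<lambda>t. poly p (cos t) * cos (real k * t)) integrable_on {0..pi}" for p k
    by (intro integrable_continuous_real continuous_intros)
  have "((\<lambda>t. poly g (cos t) * cos (real n * t) - 
      (?d (cos t) * cos (real (n - 1) * t) - ?d (cos t) * cos (real (n + 1) * t)) / (2 * real n)) has_integral
     poly g (cos pi) * sin (real n * pi) / real n - poly g (cos 0) * sin (real n * 0) / real n) {0..pi}"
  proof (rule fundamental_theorem_of_calculus)
    fix t :: real
    have a: "cos (real (n - 1) * t) = cos (real n * t) * cos t + sin (real n * t) * sin t"
      using assms cos_diff[of "real n * t" t] by (simp add: of_nat_diff algebra_simps)
    have b: "cos (real (n + 1) * t) = cos (real n * t) * cos t - sin (real n * t) * sin t"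
      using cos_add[of "real n * t" t] by (simp add: algebra_simps)
    show "((\<lambda>t. poly g (cos t) * sin (real n * t) / real n) has_vector_derivative
       poly g (cos t) * cos (real n * t) - 
      (?d (cos t) * cos (real (n - 1) * t) - ?d (cos t) * cos (real (n + 1) * t)) / (2 * real n)) (at t within {0..pi})"
      unfolding has_real_derivative_iff_has_vector_derivative[symmetric] a b
      using assms
      by (auto intro!: derivative_eq_intros DERIV_chain2[OF poly_DERIV] simp: field_simps)
  qed simp
  then have "((\<lambda>t. poly g (cos t) * cos (real n * t) - 
      (?d (cos t) * cos (real (n - 1) * t) - ?d (cos t) * cos (real (n + 1) * t)) / (2 * real n)) has_integral 0) {0..pi}"
    by simp
  moreover have "((\<lambda>t. poly g (cos t) * cos (real n * t) - 
      (?d (cos t) * cos (real (n - 1) * t) - ?d (cos t) * cos (real (n + 1) * t)) / (2 * real n)) has_integral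
      ?I n (poly g) - (?I (n - 1) ?d - ?I (n + 1) ?d) / (2 * real n)) {0..pi}"
    by (intro has_integral_diff has_integral_divide integrable_integral int)
  ultimately have "?I n (poly g) - (?I (n - 1) ?d - ?I (n + 1) ?d) / (2 * real n) = 0"
    by (rule has_integral_unique[symmetric])
  then show ?thesis
    by (simp add: cheb_coeff_def field_simps)
qed

text \<open>Each integration by parts divides by the current index and lowers it by at most one, so
  the divisors are at worst \<open>n, n - 1, ..., n - k + 1\<close>, with product
  \<open>fact k * (n choose k)\<close>.\<close>

lemma abs_cheb_coeff_poly_le:
  assumes "\<And>y. \<bar>y\<bar> \<le> 1 \<Longrightarrow> \<bar>poly ((pderiv ^^ k) g) y\<bar> \<le> M" "k \<le> n"
  shows "\<bar>cheb_coeff n (poly g)\<bar> \<le> 2 * M / (fact k * real (n choose k))"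
  using assms
proof (induction k arbitrary: g n)
  case 0
  then show ?case using abs_cheb_coeff_le[of "poly g" M n] by (simp add: continuous_on_poly)
next
  case (Suc k)
  then have n: "n \<ge> 1" "k \<le> n - 1" by auto
  have M: "M \<ge> 0" using Suc.prems(1)[of 0] by simp
  have IH: "\<bar>cheb_coeff j (poly (pderiv g))\<bar> \<le> 2 * M / (fact k * real (j choose k))" if "k \<le> j" for j
    by (rule Suc.IH) (use Suc.prems that in \<open>auto simp: funpow_swap1\<close>)
  \<comment> \<open>The term with the raised index obeys the bound for the lowered one. The two
    equal bounds then cancel the 2 in \<open>2 * n\<close>, so the constant does not grow along the
    induction.\<close>
  have "2 * M / (fact k * real ((n + 1) choose k)) \<le> 2 * M / (fact k * real ((n - 1) choose k))"
    using M n by (intro divide_left_mono mult_left_mono mult_pos_pos) (auto intro: binomial_right_mono)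
  then have "\<bar>cheb_coeff (n + 1) (poly (pderiv g))\<bar> \<le> 2 * M / (fact k * real ((n - 1) choose k))"
    using IH[of "n + 1"] n by linarith
  then have "\<bar>cheb_coeff n (poly g)\<bar> \<le> (2 * (2 * M / (fact k * real ((n - 1) choose k)))) / (2 * real n)"
    unfolding cheb_coeff_pderiv[OF n(1)] abs_divide
    using IH[OF n(2)] n(1) by (intro frac_le) auto
  also have "\<dots> = 2 * M / (fact k * (real n * real ((n - 1) choose k)))" by simp
  also have "real n * real ((n - 1) choose k) = real (Suc k) * real (n choose Suc k)"
    by (metis binomial_absorption of_nat_mult)
  finally show ?case by (simp add: mult_ac)
qed

section \<open>Orthogonality of the Chebyshev polynomials\<close>

lemma integral_cos_nat: "integral {0..pi} (\<lambda>t. cos (real k * t)) = (if k = 0 then pi else 0)"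
proof (cases "k = 0")
  case False
  have "((\<lambda>t. cos (real k * t)) has_integral sin (real k * pi) / real k - sin (real k * 0) / real k) {0..pi}"
  proof (rule fundamental_theorem_of_calculus)
    fix t :: real
    show "((\<lambda>t. sin (real k * t) / real k) has_vector_derivative cos (real k * t)) (at t within {0..pi})"
      unfolding has_real_derivative_iff_has_vector_derivative[symmetric]
      using False by (auto intro!: derivative_eq_intros)
  qed simp
  then show ?thesis using False by (simp add: integral_unique)
qed simp

lemma cheb_coeff_chebT:
  "cheb_coeff n (poly (chebT k)) = (if n = k then if n = 0 then 2 else 1 else 0)"
proof -
  \<comment> \<open>The order \<open>i \<le> j\<close> keeps the natural subtraction
    \<open>j - i\<close> from truncating; symmetry of the product covers the other order.\<close>
  have gen: "integral {0..pi} (\<lambda>t. cos (real i * t) * cos (real j * t))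
      = (if i = j then if j = 0 then pi else pi / 2 else 0)" if "i \<le> j" for i j
  proof -
    have "cos (real i * t) * cos (real j * t) = (cos (real (j - i) * t) + cos (real (i + j) * t)) / 2" for t
      using cos_times_cos[of "real j * t" "real i * t"] that
      by (simp add: of_nat_diff algebra_simps)
    then have "integral {0..pi} (\<lambda>t. cos (real i * t) * cos (real j * t)) = 
       integral {0..pi} (\<lambda>t. (cos (real (j - i) * t) + cos (real (i + j) * t)) / 2)" by (simp only:)
    also have "\<dots> = (integral {0..pi} (\<lambda>t. cos (real (j - i) * t)) + integral {0..pi} (\<lambda>t. cos (real (i + j) * t))) / 2"
      unfolding integral_divide
      by (subst integral_add) (intro integrable_continuous_real continuous_intros refl)+
    also have "\<dots> = (if i = j then if j = 0 then pi else pi / 2 else 0)"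
      unfolding integral_cos_nat using that by auto
    finally show ?thesis .
  qed
  have "integral {0..pi} (\<lambda>t. cos (real k * t) * cos (real n * t))
      = (if n = k then if n = 0 then pi else pi / 2 else 0)"
    using gen[of k n] gen[of n k] by (cases "k \<le> n") (auto simp: mult.commute)
  then show ?thesis by (simp add: cheb_coeff_def poly_chebT_cos)
qed

lemma cheb_coeff_chebT_sum:
  assumes "n \<le> m"
  shows "cheb_coeff n (poly (\<Sum>k\<le>m. smult (c k) (chebT k))) = (if n = 0 then 2 else 1) * c n"
proof -
  have "integral {0..pi} (\<lambda>t. poly (\<Sum>k\<le>m. smult (c k) (chebT k)) (cos t) * cos (real n * t)) 
     = integral {0..pi} (\<lambda>t. \<Sum>k\<le>m. c k * (poly (chebT k) (cos t) * cos (real n * t)))"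
    by (simp add: poly_sum sum_distrib_right mult.assoc)
  also have "\<dots> = (\<Sum>k\<le>m. integral {0..pi} (\<lambda>t. c k * (poly (chebT k) (cos t) * cos (real n * t))))"
    by (intro integral_sum integrable_continuous_real continuous_intros) auto
  finally have "cheb_coeff n (poly (\<Sum>k\<le>m. smult (c k) (chebT k))) = (\<Sum>k\<le>m. c k * cheb_coeff n (poly (chebT k)))"
    by (simp add: cheb_coeff_def sum_distrib_left mult_ac)
  also have "\<dots> = (\<Sum>k\<le>m. if n = k then (if n = 0 then 2 else 1) * c n else 0)"
    by (intro sum.cong) (auto simp: cheb_coeff_chebT)
  finally show ?thesis using assms by simp
qed

subsection \<open>Approximation by truncated Chebyshev sums\<close>

lemma ex_poly_antiderivative: "\<exists>P :: real poly. pderiv P = p \<and> poly P a = c"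
proof -
  define P where "P = (\<Sum>i\<le>degree p. monom (coeff p i / (real i + 1)) (Suc i))"
  have "coeff (pderiv P) i = coeff p i" for i
    by (auto simp: P_def coeff_pderiv coeff_sum coeff_eq_0 add_ac if_distrib[of "\<lambda>x. _ * x"] cong: if_cong)
  then have "pderiv P = p" by (simp add: poly_eq_iff)
  then show ?thesis
    by (intro exI[of _ "P + [:c - poly P a:]"]) (simp add: pderiv_add pderiv_pCons)
qed

lemma ex_poly_uniform_approx:
  fixes f :: "real \<Rightarrow> real"
  assumes "continuous_on {a..b} f" "\<epsilon> > 0"
  shows "\<exists>p. \<forall>x\<in>{a..b}. \<bar>f x - poly p x\<bar> \<le> \<epsilon>"
proof -
  obtain g where g: "real_polynomial_function g" "\<And>x. x \<in> {a..b} \<Longrightarrow> \<bar>f x - g x\<bar> < \<epsilon>"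
    using Stone_Weierstrass_real_polynomial_function[OF compact_Icc assms] by blast
  then obtain c n where "g = (\<lambda>x. \<Sum>i\<le>n. c i * x ^ i)"
    by (auto simp: real_polynomial_function_iff_sum)
  then have "g = poly (\<Sum>i\<le>n. monom (c i) i)"
    by (simp add: poly_sum poly_monom fun_eq_iff)
  then show ?thesis using g(2) less_imp_le by blast
qed

text \<open>The decay of coefficients is proved for polynomials only; this reduces smooth functions
  to them. Weierstrass approximation is applied to \<open>u k\<close>, then \<open>k\<close>
  antiderivatives are taken, each enlarging the error by at most the factor
  \<open>b - a\<close>.\<close>

lemma ex_poly_derivs_approx:
  fixes u :: "nat \<Rightarrow> real \<Rightarrow> real"
  assumes "a \<le> b" "\<epsilon> > 0"
    and "\<And>i x. x \<in> {a..b} \<Longrightarrow> (u i has_real_derivative u (Suc i) x) (at x within {a..b})"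
  shows "\<exists>p. \<forall>x\<in>{a..b}. \<bar>u 0 x - poly p x\<bar> \<le> \<epsilon> * (b - a) ^ k \<and>
           \<bar>u k x - poly ((pderiv ^^ k) p) x\<bar> \<le> \<epsilon>"
  using assms(3)
proof (induction k arbitrary: u)
  case 0
  have "continuous_on {a..b} (u 0)"
    by (rule DERIV_continuous_on) (use 0 in blast)
  from ex_poly_uniform_approx[OF this assms(2)] show ?case by simp
next
  case (Suc k)
  have "\<exists>p. \<forall>x\<in>{a..b}. \<bar>u (Suc 0) x - poly p x\<bar> \<le> \<epsilon> * (b - a) ^ k \<and>
      \<bar>u (Suc k) x - poly ((pderiv ^^ k) p) x\<bar> \<le> \<epsilon>"
    using Suc.IH[of "\<lambda>i. u (Suc i)"] Suc.prems by blast
  then obtain p where p: "\<And>x. x \<in> {a..b} \<Longrightarrow> \<bar>u (Suc 0) x - poly p x\<bar> \<le> \<epsilon> * (b - a) ^ k"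
      "\<And>x. x \<in> {a..b} \<Longrightarrow> \<bar>u (Suc k) x - poly ((pderiv ^^ k) p) x\<bar> \<le> \<epsilon>" by blast
  \<comment> \<open>The constant of integration makes the error vanish at \<open>a\<close>, so the
    mean value inequality bounds it elsewhere.\<close>
  obtain P where P: "pderiv P = p" "poly P a = u 0 a" using ex_poly_antiderivative by blast
  have "\<bar>u 0 x - poly P x\<bar> \<le> \<epsilon> * (b - a) ^ Suc k" if x: "x \<in> {a..b}" for x
  proof -
    have "norm ((u 0 x - poly P x) - (u 0 a - poly P a)) \<le> (\<epsilon> * (b - a) ^ k) * norm (x - a)"
    proof (rule field_differentiable_bound[where S = "{a..b}"])
      fix z assume z: "z \<in> {a..b}"
      show "((\<lambda>z. u 0 z - poly P z) has_field_derivative (u (Suc 0) z - poly p z)) (at z within {a..b})"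
        using Suc.prems[OF z, of 0] P(1)
        by (auto intro!: derivative_intros poly_DERIV[THEN has_field_derivative_at_within])
      show "norm (u (Suc 0) z - poly p z) \<le> \<epsilon> * (b - a) ^ k" using p(1)[OF z] by simp
    qed (use x in auto)
    also have "\<dots> \<le> (\<epsilon> * (b - a) ^ k) * (b - a)"
      using x assms by (intro mult_left_mono) auto
    finally show ?thesis using P(2) by (simp add: mult_ac)
  qed
  then show ?case using p(2) P(1) by (intro exI[of _ P]) (auto simp: funpow_swap1)
qed

text \<open>The sum telescopes: its term at \<open>n\<close> equals
  \<open>(1 / ((n - 1) choose j) - 1 / (n choose j)) / (j * fact j)\<close>. The bound is
  independent of \<open>D\<close>, which matters because the degree of the approximating polynomial
  is not controlled.\<close>

lemma sum_inverse_binomial_le: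
  assumes "1 \<le> j" "j \<le> m" "m \<le> D"
  shows "(\<Sum>n\<in>{m<..D}. 1 / (fact (Suc j) * real (n choose Suc j))) \<le> 1 / (real j * fact j * real (m choose j))"
proof -
  have "(\<Sum>n\<in>{m<..D}. 1 / (fact (Suc j) * real (n choose Suc j)))
      = (1 / real (m choose j) - 1 / real (D choose j)) / (real j * fact j)"
    using assms(3)
  proof (induction D rule: dec_induct)
    case (step n)
    have pos: "real (n choose j) > 0" "real n > 0" "real (Suc n) - real j > 0" using assms step by auto
    have "real (Suc j) * real (Suc n choose Suc j) = real (Suc n) * real (n choose j)"
      by (metis Suc_times_binomial of_nat_mult)
    then have 1: "1 / (fact (Suc j) * real (Suc n choose Suc j)) = 1 / (fact j * (real (Suc n) * real (n choose j)))"
      by (simp add: mult_ac del: of_nat_Suc)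
    have "(real (Suc n) - real j) * real (Suc n choose j) = real (Suc n) * real (n choose j)"
      using binomial_absorb_comp[of "Suc n" j] assms step
      by (metis Suc_leI diff_Suc_1 le_Suc_eq le_trans of_nat_diff of_nat_mult)
    then have 2: "1 / real (Suc n choose j) = (real (Suc n) - real j) / (real (Suc n) * real (n choose j))"
      using pos by (simp add: field_simps del: of_nat_Suc) 
    have "{m<..Suc n} = insert (Suc n) {m<..n}" using step by auto
    then have "(\<Sum>n\<in>{m<..Suc n}. 1 / (fact (Suc j) * real (n choose Suc j))) = 
       1 / (fact j * (real (Suc n) * real (n choose j))) + 
       (1 / real (m choose j) - 1 / real (n choose j)) / (real j * fact j)"
      using step 1 by simp
    also have "\<dots> = (1 / real (m choose j) - 1 / real (Suc n choose j)) / (real j * fact j)"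
    proof -
      have "1 / (F * (s * c)) + (X - 1 / c) / (t * F) = (X - (s - t) / (s * c)) / (t * F)"
        if "F > 0" "s > 0" "c > 0" "t > 0" for F s c t X :: real
        using that by (simp add: field_simps)
      from this[of "fact j" "real (Suc n)" "real (n choose j)" "real j" "1 / real (m choose j)"]
      show ?thesis unfolding 2 using pos assms by simp
    qed
    finally show ?case .
  qed simp
  also have "\<dots> \<le> (1 / real (m choose j)) / (real j * fact j)"
    by (intro divide_right_mono) auto
  finally show ?thesis by (simp add: mult_ac)
qed

text \<open>The Chebyshev expansion of \<open>g\<close> is cut off after degree \<open>m\<close>.
  One derivative more than \<open>j\<close> is used because summing the tail of the coefficient
  bounds costs one order of decay.\<close>

lemma poly_truncation_bound:
  assumes "1 \<le> j" "j \<le> m"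
    and M: "\<And>y. \<bar>y\<bar> \<le> 1 \<Longrightarrow> \<bar>poly ((pderiv ^^ Suc j) g) y\<bar> \<le> M"
  shows "\<exists>q. degree q \<le> m \<and> (\<forall>y. \<bar>y\<bar> \<le> 1 \<longrightarrow>
    \<bar>poly g y - poly q y\<bar> \<le> 2 * M / (real j * fact j * real (m choose j)))"
proof -
  define D where "D = max m (degree g)"
  obtain c where c: "g = (\<Sum>n\<le>D. smult (c n) (chebT n))"
    using ex_chebT_sum[of g D] by (auto simp: D_def)
  define q where "q = (\<Sum>n\<le>m. smult (c n) (chebT n))"
  have M0: "M \<ge> 0" using M[of 0] by simp
  \<comment> \<open>Here \<open>n > m\<close> gives both \<open>n \<ge> Suc j\<close>, as the
    coefficient bound requires, and \<open>n > 0\<close>, so that \<open>cheb_coeff\<close> returns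
    \<open>c n\<close> itself.\<close>
  have cn: "\<bar>c n\<bar> \<le> 2 * M / (fact (Suc j) * real (n choose Suc j))" if "n \<in> {m<..D}" for n
    using abs_cheb_coeff_poly_le[of "Suc j" g M n] cheb_coeff_chebT_sum[of n D c] M c that assms
    by (auto simp del: fact_Suc)
  have "{..D} = {..m} \<union> {m<..D}" by (auto simp: D_def)
  then have gq: "g = q + (\<Sum>n\<in>{m<..D}. smult (c n) (chebT n))"
    unfolding q_def by (subst c) (simp, subst sum.union_disjoint, auto)
  have "\<bar>poly g y - poly q y\<bar> \<le> 2 * M / (real j * fact j * real (m choose j))" if "\<bar>y\<bar> \<le> 1" for y
  proof -
    have "\<bar>poly g y - poly q y\<bar> = \<bar>\<Sum>n\<in>{m<..D}. c n * poly (chebT n) y\<bar>"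
      by (subst gq) (simp add: poly_sum)
    also have "\<dots> \<le> (\<Sum>n\<in>{m<..D}. \<bar>c n * poly (chebT n) y\<bar>)" by (rule sum_abs)
    also have "\<dots> \<le> (\<Sum>n\<in>{m<..D}. 2 * M / (fact (Suc j) * real (n choose Suc j)))"
    proof (rule sum_mono)
      fix n assume "n \<in> {m<..D}"
      then have "\<bar>c n\<bar> * \<bar>poly (chebT n) y\<bar> \<le> 2 * M / (fact (Suc j) * real (n choose Suc j)) * 1"
        using cn abs_poly_chebT_le_1[OF that] M0 by (intro mult_mono) (auto simp del: fact_Suc)
      then show "\<bar>c n * poly (chebT n) y\<bar> \<le> 2 * M / (fact (Suc j) * real (n choose Suc j))"
        by (simp add: abs_mult del: fact_Suc)
    qed
    also have "\<dots> = 2 * M * (\<Sum>n\<in>{m<..D}. 1 / (fact (Suc j) * real (n choose Suc j)))"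
      by (simp add: sum_distrib_left del: fact_Suc)
    also have "\<dots> \<le> 2 * M * (1 / (real j * fact j * real (m choose j)))"
      using M0 assms by (intro mult_left_mono sum_inverse_binomial_le) (auto simp: D_def)
    finally show ?thesis by simp
  qed
  moreover have "degree q \<le> m"
    unfolding q_def by (intro degree_sum_le) 
      (auto intro: order_trans[OF degree_smult_le] order_trans[OF degree_chebT_le])
  ultimately show ?thesis by blast
qed

section \<open>Transfer from \<open>[-1,1]\<close> to \<open>[a,b]\<close>\<close>

lemma funpow_pderiv_pcompose_linear:
  "(pderiv ^^ k) (pcompose p [:c, h:]) = smult (h ^ k) (pcompose ((pderiv ^^ k) p) [:c, h:])"
  for h :: real
proof (induction k)
  case (Suc k)
  then show ?case 
    by (simp add: pderiv_smult pderiv_pcompose pderiv_pCons mult_ac)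
qed simp

text \<open>A polynomial close to \<open>u 0\<close>, with close derivative of order
  \<open>Suc j\<close>, is rescaled to \<open>[-1,1]\<close>, truncated there and rescaled back.
  Every derivative contributes a factor \<open>(b - a) / 2\<close>.\<close>

lemma poly_approx_Icc:
  fixes u :: "nat \<Rightarrow> real \<Rightarrow> real"
  assumes "a < b" "\<epsilon> > 0" "1 \<le> j" "j \<le> m"
    and u: "\<And>i x. x \<in> {a..b} \<Longrightarrow> (u i has_real_derivative u (Suc i) x) (at x within {a..b})"
    and M: "\<And>x. x \<in> {a..b} \<Longrightarrow> \<bar>u (Suc j) x\<bar> \<le> M"
  shows "\<exists>q. degree q \<le> m \<and> (\<forall>x\<in>{a..b}. \<bar>u 0 x - poly q x\<bar>
     \<le> 2 * (((b - a) / 2) ^ Suc j * M) / (real j * fact j * real (m choose j)) + \<epsilon>)"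
proof -
  define h where "h = (b - a) / 2"
  define z where "z = (a + b) / 2"
  define K where "K = real j * fact j * real (m choose j)"
  have h: "h > 0" and K: "K > 0" using assms by (auto simp: h_def K_def)
  \<comment> \<open>An accuracy \<open>e\<close> of the derivative enters the final error twice: as
    \<open>e * (b - a) ^ Suc j\<close> when \<open>u 0\<close> is replaced by \<open>p\<close>, and
    as \<open>2 * h ^ Suc j * e / K\<close> through the truncation. Hence
    \<open>e = \<epsilon> / S\<close> is the right choice.\<close>
  define S where "S = (b - a) ^ Suc j + 2 * h ^ Suc j / K"
  have S: "S > 0" using h K assms by (auto simp: S_def intro!: add_pos_pos)
  obtain p where p: "\<And>x. x \<in> {a..b} \<Longrightarrow> \<bar>u 0 x - poly p x\<bar> \<le> \<epsilon> / S * (b - a) ^ Suc j"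
      "\<And>x. x \<in> {a..b} \<Longrightarrow> \<bar>u (Suc j) x - poly ((pderiv ^^ Suc j) p) x\<bar> \<le> \<epsilon> / S"
    using ex_poly_derivs_approx[of a b "\<epsilon> / S" u "Suc j"] u S assms(1,2)
    by (meson divide_pos_pos less_imp_le)
  define g where "g = pcompose p [:z, h:]"
  have z_in: "z + h * y \<in> {a..b}" if "\<bar>y\<bar> \<le> 1" for y
  proof -
    have "\<bar>h * y\<bar> \<le> h" using that h by (simp add: abs_mult mult_left_le)
    then show ?thesis by (auto simp: z_def h_def abs_le_iff field_simps)
  qed
  have "\<bar>poly ((pderiv ^^ Suc j) g) y\<bar> \<le> h ^ Suc j * (M + \<epsilon> / S)" if "\<bar>y\<bar> \<le> 1" for y
  proof -
    have "\<bar>poly ((pderiv ^^ Suc j) p) (z + h * y)\<bar> \<le> M + \<epsilon> / S"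
      using p(2)[OF z_in[OF that]] M[OF z_in[OF that]] by linarith
    then show ?thesis using h
      unfolding g_def funpow_pderiv_pcompose_linear 
      by (simp add: abs_mult poly_pcompose mult.commute del: funpow.simps power_Suc)
  qed
  from poly_truncation_bound[OF assms(3,4) this] obtain q where q: "degree q \<le> m"
     "\<And>y. \<bar>y\<bar> \<le> 1 \<Longrightarrow> \<bar>poly g y - poly q y\<bar> \<le> 2 * (h ^ Suc j * (M + \<epsilon> / S)) / K"
    unfolding K_def by blast
  define r where "r = pcompose q [:- z / h, 1 / h:]"
  have "\<bar>u 0 x - poly r x\<bar> \<le> 2 * (h ^ Suc j * M) / K + \<epsilon>" if x: "x \<in> {a..b}" for x
  proof -
    define y where "y = (x - z) / h"
    have y: "\<bar>y\<bar> \<le> 1" "z + h * y = x" using h x by (auto simp: y_def z_def h_def abs_le_iff field_simps)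
    have "poly r x = poly q y" by (simp add: r_def poly_pcompose y_def diff_divide_distrib)
    moreover have "poly g y = poly p x" using y by (simp add: g_def poly_pcompose mult.commute)
    ultimately have "\<bar>u 0 x - poly r x\<bar> \<le> \<epsilon> / S * (b - a) ^ Suc j + 2 * (h ^ Suc j * (M + \<epsilon> / S)) / K"
      using q(2)[OF y(1)] p(1)[OF x] by linarith
    also have "\<dots> = 2 * (h ^ Suc j * M) / K + \<epsilon> / S * S"
    proof -
      have "e * d + 2 * (t * (M + e)) / K = 2 * (t * M) / K + e * (d + 2 * t / K)" for e d t :: real
        by (simp add: algebra_simps add_divide_distrib)
      then show ?thesis unfolding S_def .
    qed
    finally show ?thesis using S by simp
  qed
  moreover have "degree r \<le> m"
    using q(1) degree_pcompose_le[of q "[:- z / h, 1 / h:]"] h by (simp add: r_def)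
  ultimately show ?thesis unfolding h_def K_def by blast
qed

lemma deriv_within_has_real_derivative:
  assumes "smooth_on_Icc a b f" "a < b" "x \<in> {a..b}"
  shows "(deriv_within a b k f has_real_derivative deriv_within a b (Suc k) f x) (at x within {a..b})"
proof -
  have "deriv_within a b k f differentiable (at x within {a..b})"
    using assms by (auto simp: smooth_on_Icc_def differentiable_on_def)
  then show ?thesis
    unfolding has_real_derivative_iff_has_vector_derivative deriv_within.simps
    using vector_derivative_works by blast
qed

subsection \<open>Existence of best approximants\<close>

text \<open>Without boundedness the supremum in \<open>maxnorm\<close> need not be an upper
  bound.\<close>

lemma bdd_above_abs_continuous:
  fixes g :: "real \<Rightarrow> real"
  assumes "continuous_on {a..b} g"
  shows "bdd_above ((\<lambda>x. \<bar>g x\<bar>) ` {a..b})"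
  by (intro bounded_imp_bdd_above compact_imp_bounded compact_continuous_image continuous_intros assms compact_Icc)

lemma abs_le_maxnorm:
  assumes "continuous_on {a..b} g" "x \<in> {a..b}"
  shows "\<bar>g x\<bar> \<le> maxnorm a b g"
  unfolding maxnorm_def using bdd_above_abs_continuous[OF assms(1)] assms(2) by (intro cSUP_upper)

lemma maxnorm_le:
  assumes "a \<le> b" "\<And>x. x \<in> {a..b} \<Longrightarrow> \<bar>g x\<bar> \<le> K"
  shows "maxnorm a b g \<le> K"
  unfolding maxnorm_def using assms by (intro cSUP_least) auto

text \<open>Tychonoff's theorem. Coefficient vectors are encoded as infinite sequences, so that the
  product topology on functions applies directly.\<close>

lemma compact_cube: "compact {c :: nat \<Rightarrow> real. \<forall>i. c i \<in> {-K..K}}"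
proof -
  have "compactin (product_topology (\<lambda>_. euclidean) UNIV) (PiE UNIV (\<lambda>_::nat. {-K..K::real}))"
    unfolding compactin_PiE by simp
  then show ?thesis
    by (simp add: euclidean_product_topology PiE_UNIV_domain Pi_def)
qed

text \<open>By compactness of bounded sets of Chebyshev coefficients, the sets of almost best
  approximants have a common element.\<close>

lemma ex_best_approx:
  fixes f :: "real \<Rightarrow> real"
  assumes "a < b" and f: "continuous_on {a..b} f"
  shows "\<exists>q. is_arg_min (\<lambda>p. maxnorm a b (\<lambda>x. f x - poly p x)) (\<lambda>p. p \<in> polys m) q"
proof -
  define F where "F = (\<lambda>p. maxnorm a b (\<lambda>x. f x - poly p x))"
  have cont: "continuous_on {a..b} (\<lambda>x. f x - poly p x)" for p
    by (intro continuous_intros f)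
  have F_nonneg: "F p \<ge> 0" for p
    using abs_le_maxnorm[OF cont, of a p] assms(1) unfolding F_def by (auto intro: order_trans[OF abs_ge_zero])
  define E where "E = Inf (F ` polys m)"
  have ne: "F ` polys m \<noteq> {}" using degree_0[where 'a=real] by (auto simp: polys_def intro!: exI[of _ 0])
  have bdd: "bdd_below (F ` polys m)" using F_nonneg by (intro bdd_belowI[of _ 0]) auto
  have E_le: "E \<le> F p" if "p \<in> polys m" for p
    unfolding E_def using bdd that by (auto intro: cINF_lower)
  define h where "h = (b - a) / 2"
  define z where "z = (a + b) / 2"
  have h: "h > 0" using assms by (simp add: h_def)
  define T where "T = (\<lambda>n. pcompose (chebT n) [:- z / h, 1 / h:])"
  have degT: "degree (T n) \<le> n" for n
    using degree_pcompose_le[of "chebT n" "[:- z / h, 1 / h:]"] degree_chebT_le[of n] h by (simp add: T_def)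
  define Q where "Q = (\<lambda>c. \<Sum>n\<le>m. smult (c n) (T n))"
  have Q_poly: "Q c \<in> polys m" for c
    unfolding Q_def polys_def
    by (auto intro!: degree_sum_le intro: order_trans[OF degree_smult_le] order_trans[OF degT])
  \<comment> \<open>A polynomial with error at most \<open>E + 1\<close> is bounded by
    \<open>K / 2\<close> on \<open>[a,b]\<close>, and Chebyshev coefficients are at most twice the
    bound of the function.\<close>
  define K where "K = 2 * (E + 1 + maxnorm a b f)"
  have z_in: "z + h * y \<in> {a..b}" if "\<bar>y\<bar> \<le> 1" for y
  proof -
    have "\<bar>h * y\<bar> \<le> h" using that h by (simp add: abs_mult mult_left_le)
    then show ?thesis by (auto simp: z_def h_def abs_le_iff field_simps)
  qed
  have rep: "\<exists>c. (\<forall>i. c i \<in> {-K..K}) \<and> p = Q c" if p: "p \<in> polys m" "F p \<le> E + 1" for p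
  proof -
    define g where "g = pcompose p [:z, h:]"
    have "degree g \<le> m" 
      using p(1) degree_pcompose_le[of p "[:z, h:]"] h by (simp add: g_def polys_def)
    then obtain c where c: "g = (\<Sum>n\<le>m. smult (c n) (chebT n))" using ex_chebT_sum by blast
    have "\<bar>poly g y\<bar> \<le> K / 2" if "\<bar>y\<bar> \<le> 1" for y
    proof -
      have "poly g y = poly p (z + h * y)" by (simp add: g_def poly_pcompose mult.commute)
      moreover have "\<bar>f (z + h * y) - poly p (z + h * y)\<bar> \<le> E + 1"
        using abs_le_maxnorm[OF cont z_in[OF that], of p] p(2) by (simp add: F_def)
      moreover have "\<bar>f (z + h * y)\<bar> \<le> maxnorm a b f"
        by (rule abs_le_maxnorm[OF f z_in[OF that]])
      ultimately have "\<bar>poly g y\<bar> \<le> (E + 1) + maxnorm a b f" by linarith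
      then show ?thesis by (simp add: K_def)
    qed
    then have le: "\<bar>cheb_coeff n (poly g)\<bar> \<le> K" for n
      using abs_cheb_coeff_le[of "poly g" "K / 2" n] by (simp add: continuous_on_poly)
    have K0: "K \<ge> 0" using le[of 0] by linarith
    \<comment> \<open>Entries beyond \<open>m\<close> do not enter \<open>Q\<close>; setting them to
      zero places the sequence in the cube.\<close>
    define d where "d = (\<lambda>n. if n \<le> m then c n else 0)"
    have "d n \<in> {-K..K}" for n
      using le[of n] cheb_coeff_chebT_sum[of n m c] c K0 
      by (auto simp: d_def abs_le_iff split: if_splits)
    moreover have "p = Q d"
    proof -
      have "[:z, h:] \<circ>\<^sub>p [:- z / h, 1 / h:] = [:0, 1:]" using h by (simp add: pcompose_pCons)
      then have "p = pcompose g [:- z / h, 1 / h:]"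
        by (simp add: g_def pcompose_assoc[symmetric] pcompose_idR)
      also have "\<dots> = Q d"
        unfolding c Q_def T_def by (simp add: pcompose_sum pcompose_smult d_def)
      finally show ?thesis .
    qed
    ultimately show ?thesis by blast
  qed
  define S where "S = {c :: nat \<Rightarrow> real. \<forall>i. c i \<in> {-K..K}}"
  define Z where "Z = (\<lambda>k::nat. {c. \<forall>x\<in>{a..b}. \<bar>f x - poly (Q c) x\<bar> \<le> E + 1 / real (Suc k)})"
  have "S \<inter> (\<Inter>k\<in>UNIV. Z k) \<noteq> {}"
  \<comment> \<open>Each \<open>Z k\<close> is closed, since every condition in it is a continuous
    inequality in finitely many coordinates; what remains is the finite intersection property within
    \<open>S\<close>.\<close>
  proof (rule compact_imp_fip_image)
    show "compact S" unfolding S_def by (rule compact_cube)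
    fix k
    have "Z k = (\<Inter>x\<in>{a..b}. {c. \<bar>f x - (\<Sum>n\<le>m. c n * poly (T n) x)\<bar> \<le> E + 1 / real (Suc k)})"
      by (auto simp: Z_def Q_def poly_sum)
    then show "closed (Z k)"
      by (auto intro!: closed_INT closed_Collect_le continuous_intros simp del: of_nat_Suc)
  next
    fix I :: "nat set" assume I: "finite I"
    \<comment> \<open>The sets \<open>Z k\<close> shrink as \<open>k\<close> grows, so a point for
      the largest index suffices; inserting \<open>0\<close> covers empty \<open>I\<close>.\<close>
    define k where "k = Max (insert 0 I)"
    have k: "i \<le> k" if "i \<in> I" for i using I that by (simp add: k_def)
    have "Inf (F ` polys m) < E + 1 / real (Suc k)" by (simp add: E_def)
    then obtain p where p: "p \<in> polys m" "F p < E + 1 / real (Suc k)"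
      using ne bdd by (auto simp: cInf_less_iff simp del: of_nat_Suc)
    have "1 / real (Suc k) \<le> 1" by simp
    then have "F p \<le> E + 1" using p(2) by linarith
    then obtain c where c: "c \<in> S" "p = Q c" using rep[OF p(1)] by (auto simp: S_def)
    have "c \<in> Z i" if "i \<in> I" for i
    proof -
      have "1 / real (Suc k) \<le> 1 / real (Suc i)" using k[OF that] by (simp add: frac_le)
      then have "F (Q c) \<le> E + 1 / real (Suc i)" using p(2) unfolding c(2) by linarith
      then show ?thesis unfolding Z_def F_def
        using order_trans[OF abs_le_maxnorm[OF cont, of _ "Q c"]] by blast
    qed
    then show "S \<inter> (\<Inter>k\<in>I. Z k) \<noteq> {}" using c(1) by blast
  qed
  then obtain c where c: "\<And>k. c \<in> Z k" by blast
  have "F (Q c) \<le> E + 1 / real (Suc k)" for k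
    unfolding F_def using c[of k] assms by (intro maxnorm_le) (auto simp: Z_def)
  then have "F (Q c) \<le> E"
    by (intro LIMSEQ_le_const[where X = "\<lambda>k. E + 1 / real (Suc k)"])
       (use tendsto_add[OF tendsto_const LIMSEQ_inverse_real_of_nat, of E] in \<open>auto simp: inverse_eq_divide\<close>)
  then have "is_arg_min F (\<lambda>p. p \<in> polys m) (Q c)"
    unfolding is_arg_min_def using Q_poly E_le by (metis leD order_trans)
  then show ?thesis unfolding F_def by blast
qed

subsection \<open>Gevrey functions\<close>

text \<open>Both sides are falling factorials, compared factor by factor: \<open>(L - i) powr
  \<delta> \<le> (L - i) * L powr (\<delta> - 1) = L powr \<delta> - i * L powr (\<delta> - 1) \<le>
  m - i\<close>.\<close>

lemma falling_powr_le:
  assumes "\<delta> \<ge> 1" "real L powr \<delta> \<le> real m" "j \<le> L"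
  shows "(fact j * real (L choose j)) powr \<delta> \<le> fact j * real (m choose j)"
  using assms(3)
proof (induction j)
  case (Suc j)
  have step: "fact (Suc j) * real (n choose Suc j) = (fact j * real (n choose j)) * (real n - real j)"
    if "j \<le> n" for n
  proof -
    have "real (Suc j * (n choose Suc j)) = real ((n - j) * (n choose j))"
      by (simp only: binomial_absorption binomial_absorb_comp)
    then have "real (Suc j) * real (n choose Suc j) = (real n - real j) * real (n choose j)"
      using that by (simp only: of_nat_mult of_nat_diff)
    then show ?thesis by (simp add: mult_ac del: of_nat_Suc)
  qed
  have L: "real L \<ge> 1" "real j < real L" using Suc.prems by auto
  have Lp: "real L powr (\<delta> - 1) \<ge> 1" using L assms by (simp add: ge_one_powr_ge_zero)
  have "(real L - real j) powr \<delta> = (real L - real j) * (real L - real j) powr (\<delta> - 1)"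
    using L by (simp add: powr_diff)
  also have "\<dots> \<le> (real L - real j) * real L powr (\<delta> - 1)"
    using L assms by (intro mult_left_mono powr_mono2) auto
  also have "\<dots> = real L powr \<delta> - real j * real L powr (\<delta> - 1)"
    using L by (simp add: powr_diff field_simps)
  also have "\<dots> \<le> real m - real j * 1"
    using assms Lp by (intro diff_mono mult_left_mono) auto
  finally have key: "(real L - real j) powr \<delta> \<le> real m - real j" by simp
  then have jm: "real j \<le> real m" using powr_ge_zero[of "real L - real j" \<delta>] by linarith
  have "(fact (Suc j) * real (L choose Suc j)) powr \<delta> 
      = (fact j * real (L choose j)) powr \<delta> * (real L - real j) powr \<delta>"
    using L by (simp only: step[of L] Suc.prems[THEN Suc_leD]) (simp add: powr_mult)
  also have "\<dots> \<le> (fact j * real (m choose j)) * (real m - real j)"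
    using Suc key by (intro mult_mono) auto
  also have "\<dots> = fact (Suc j) * real (m choose Suc j)"
    using jm by (simp only: step[of m] of_nat_le_iff)
  finally show ?case .
qed simp

text \<open>The Gevrey bound on the derivative of order \<open>Suc j\<close> contributes
  \<open>fact j powr \<delta>\<close>, which cancels against the lower bound on
  \<open>fact j * (m choose j)\<close> from \<open>falling_powr_le\<close>. The surplus factors
  \<open>B\<close> and \<open>Suc j powr \<delta>\<close> are absorbed by \<open>1 + B\<close> and
  \<open>(L + 1) powr \<delta>\<close>.\<close>

lemma gevrey_approx:
  assumes f: "f \<in> gevrey \<delta> a b C\<^sub>G A" and "\<delta> \<ge> 1" "a < b" "C\<^sub>G > 0" "A > 0" "real L powr \<delta> \<le> real m" "j \<le> L" "\<epsilon> > 0"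
  defines "B \<equiv> A * (b - a) / 2"
  shows "\<exists>q\<in>polys m. \<forall>x\<in>{a..b}. \<bar>f x - poly q x\<bar> \<le> 
      2 * C\<^sub>G * (1 + B) * (real L + 1) powr \<delta> * (B ^ j / real (L choose j)) + \<epsilon>"
proof -
  define u where "u = (\<lambda>k. deriv_within a b k f)"
  have B: "B > 0" using assms by (simp add: B_def)
  have bd: "\<bar>u k x\<bar> \<le> C\<^sub>G * A ^ k * fact k powr \<delta>" if "x \<in> {a..b}" for k x
    using f that by (simp add: gevrey_def u_def)
  have sm: "smooth_on_Icc a b f" using f by (simp add: gevrey_def)
  have Lp: "(real L + 1) powr \<delta> \<ge> 1" using assms by (simp add: ge_one_powr_ge_zero)
  show ?thesis
  proof (cases "j = 0")
    \<comment> \<open>The truncation bound needs \<open>j \<ge> 1\<close>. For \<open>j = 0\<close>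
      the zero polynomial is good enough, because \<open>f\<close> is bounded by
      \<open>C\<^sub>G\<close>.\<close>
    case True
    have "1 * 1 \<le> (2 * (1 + B)) * (real L + 1) powr \<delta>"
      using B Lp by (intro mult_mono) auto
    then have "C\<^sub>G * 1 \<le> C\<^sub>G * ((2 * (1 + B)) * (real L + 1) powr \<delta>)"
      using assms(4) by (intro mult_left_mono) auto
    then have "\<bar>f x - poly 0 x\<bar> \<le> 2 * C\<^sub>G * (1 + B) * (real L + 1) powr \<delta> * (B ^ j / real (L choose j)) + \<epsilon>"
      if "x \<in> {a..b}" for x
      using bd[OF that, of 0] True assms(8) by (simp add: u_def mult_ac)
    then show ?thesis by (intro bexI[of _ 0]) (auto simp: polys_def)
  next
    case False
    have fall: "(fact j * real (L choose j)) powr \<delta> \<le> fact j * real (m choose j)"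
      by (rule falling_powr_le) (use assms in auto)
    have Lj: "real (L choose j) \<ge> 1" using assms(7) by (simp add: Suc_leI zero_less_binomial_iff)
    then have "0 < fact j * real (m choose j)"
      using assms(7) by (intro less_le_trans[OF _ fall]) (auto simp: not_less)
    then have jm: "j \<le> m" by (simp add: zero_less_mult_iff)
    \<comment> \<open>Dropping the exponent \<open>\<delta>\<close> weakens the estimate to a form
      to which the binomial theorem applies.\<close>
    have "real (L choose j) powr 1 \<le> real (L choose j) powr \<delta>" using Lj assms by (intro powr_mono) auto
    then have Ljd: "real (L choose j) \<le> real (L choose j) powr \<delta>" using Lj by simp
    let ?M = "C\<^sub>G * A ^ Suc j * fact (Suc j) powr \<delta>"
    have "\<exists>q. degree q \<le> m \<and> (\<forall>x\<in>{a..b}. \<bar>u 0 x - poly q x\<bar>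
     \<le> 2 * (((b - a) / 2) ^ Suc j * ?M) / (real j * fact j * real (m choose j)) + \<epsilon>)"
      by (rule poly_approx_Icc) 
         (use assms False jm bd deriv_within_has_real_derivative[OF sm] in \<open>auto simp: u_def simp del: deriv_within.simps fact_Suc power_Suc\<close>)
    moreover have "2 * (((b - a) / 2) ^ Suc j * ?M) / (real j * fact j * real (m choose j)) \<le>
       2 * C\<^sub>G * (1 + B) * (real L + 1) powr \<delta> * (B ^ j / real (L choose j))"
    proof -
      have "fact (Suc j) powr \<delta> = (real (Suc j) * fact j) powr \<delta>" by (simp only: fact_Suc of_nat_mult of_nat_fact)
      also have "\<dots> = real (Suc j) powr \<delta> * fact j powr \<delta>" by (subst powr_mult) auto
      finally have fs: "fact (Suc j) powr \<delta> = real (Suc j) powr \<delta> * fact j powr \<delta>" .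
      have Bp: "((b - a) / 2) ^ Suc j * A ^ Suc j = B ^ Suc j"
        by (simp only: power_mult_distrib[symmetric] B_def) (simp add: mult_ac)
      have "2 * (((b - a) / 2) ^ Suc j * ?M) / (real j * fact j * real (m choose j)) 
         = 2 * C\<^sub>G * (((b - a) / 2) ^ Suc j * A ^ Suc j) * (real (Suc j) powr \<delta> * fact j powr \<delta>) / (real j * fact j * real (m choose j))"
        unfolding fs by (simp only: mult_ac)
      also have "\<dots> = 2 * C\<^sub>G * B ^ Suc j * real (Suc j) powr \<delta> * (fact j powr \<delta> / (fact j * real (m choose j))) / real j"
        unfolding Bp by (simp add: mult_ac)
      also have "\<dots> \<le> 2 * C\<^sub>G * B ^ Suc j * real (Suc j) powr \<delta> * (fact j powr \<delta> / (fact j * real (m choose j))) / 1"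
        using False B assms by (intro divide_left_mono mult_nonneg_nonneg) auto
      also have "\<dots> \<le> 2 * C\<^sub>G * B ^ Suc j * real (Suc j) powr \<delta> * (fact j powr \<delta> / (fact j * real (L choose j)) powr \<delta>)"
        using fall B assms Lj unfolding div_by_1 
        by (intro mult_left_mono divide_left_mono mult_nonneg_nonneg mult_pos_pos) (auto simp: jm)
      also have "fact j powr \<delta> / (fact j * real (L choose j)) powr \<delta> = 1 / real (L choose j) powr \<delta>"
        by (subst powr_mult) auto
      also have "2 * C\<^sub>G * B ^ Suc j * real (Suc j) powr \<delta> * (1 / real (L choose j) powr \<delta>)
          \<le> 2 * C\<^sub>G * ((1 + B) * B ^ j) * (real L + 1) powr \<delta> * (1 / real (L choose j))"
        using B assms Ljd Lj by (intro mult_mono divide_left_mono powr_mono2 mult_nonneg_nonneg mult_pos_pos) auto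
      also have "\<dots> = 2 * C\<^sub>G * (1 + B) * (real L + 1) powr \<delta> * (B ^ j / real (L choose j))"
        by simp
      finally show ?thesis .
    qed
    ultimately show ?thesis by (force simp: polys_def u_def)
  qed
qed

text \<open>Among the \<open>L + 1\<close> terms \<open>(L choose j) * (1 / B) ^ j\<close> of the
  expansion of \<open>(1 + 1 / B) ^ L\<close>, the largest is at least the average.\<close>

lemma ex_binomial_average:
  assumes "B > 0"
  shows "\<exists>j\<le>L. B ^ j / real (L choose j) \<le> (real L + 1) * (1 + 1 / B) powr (- real L)"
proof (rule ccontr)
  assume "\<not> ?thesis"
  then have gt: "(real L + 1) * (1 + 1 / B) powr (- real L) < B ^ j / real (L choose j)" if "j \<le> L" for j
    using that by (meson not_le)
  have pos: "(1 + 1 / B) ^ L > 0" using assms by (simp add: add_pos_pos)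
  have "real (L choose j) * (1 / B) ^ j < (1 + 1 / B) ^ L / (real L + 1)" if "j \<le> L" for j
  proof -
    have "(real L + 1) / (1 + 1 / B) ^ L < B ^ j / real (L choose j)"
      using gt[OF that] assms by (simp add: powr_minus powr_realpow add_pos_pos divide_inverse)
    moreover have "c * (1 / y) < P / X" if "X / P < y / c" "X > 0" "P > 0" "y > 0" "c > 0" for X P y c :: real
      using that by (simp add: field_simps)
    ultimately show ?thesis using pos assms that by (simp add: power_divide)
  qed
  then have "(\<Sum>j\<le>L. real (L choose j) * (1 / B) ^ j) < (\<Sum>j\<le>L. (1 + 1 / B) ^ L / (real L + 1))"
    by (intro sum_strict_mono) auto
  also have "\<dots> = (1 + 1 / B) ^ L" by (simp add: field_simps)
  also have "\<dots> = (\<Sum>j\<le>L. real (L choose j) * (1 / B) ^ j)"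
    by (subst add.commute) (simp add: binomial_ring)
  finally show False by simp
qed

section \<open>The convergence rate in terms of \<open>rho\<close>\<close>

lemma rho_le: 
  assumes "r \<ge> 0" shows "1 \<le> rho r" "rho r \<le> (1 + r)\<^sup>2"
proof -
  have "sqrt (1 + r\<^sup>2) \<le> 1 + r" using assms by (intro real_le_lsqrt) (simp_all add: power2_sum)
  then show "rho r \<le> (1 + r)\<^sup>2" using assms order_trans[of "sqrt (1 + r\<^sup>2)" "1 + r" "r + (1 + r\<^sup>2)"]
    by (simp add: rho_def power2_sum)
  have "1 \<le> sqrt (1 + r\<^sup>2)" by simp
  then show "1 \<le> rho r" using assms unfolding rho_def by linarith
qed

text \<open>Follows from \<open>(1 + x / p) ^ p \<le> exp x\<close>; it lets an exponential absorb
  the powers of \<open>L\<close>.\<close>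

lemma power_le_exp:
  assumes "x \<ge> 0" "p \<ge> 1"
  shows "x ^ p \<le> real p ^ p * exp x"
proof -
  have "(x / real p) ^ p \<le> (1 + x / real p) ^ p" using assms by (intro power_mono) auto
  also have "\<dots> \<le> exp x" by (rule exp_ge_one_plus_x_over_n_power_n) (use assms in auto)
  finally show ?thesis using assms by (simp add: power_divide field_simps)
qed

text \<open>With \<open>w = ln (1 + 1 / B)\<close>, the left side decays like
  \<open>exp (- L * w)\<close> up to a power of \<open>L + 1\<close>, while the rate on the right is
  at least \<open>exp (- 4 * L * w / 5)\<close>. The spare \<open>exp (- L * w / 5)\<close> absorbs
  the power.\<close>

lemma rate_bound:
  assumes "B > 0" "\<delta> \<ge> 1" "L \<ge> 1" "N \<ge> 0" "N \<le> real L + 1"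
  defines "p \<equiv> nat \<lceil>\<delta> + 1\<rceil>"
  shows "(real L + 1) powr \<delta> * ((real L + 1) * (1 + 1 / B) powr (- real L))
    \<le> (10 * real p / ln (1 + 1 / B)) ^ p * rho (1 / B) powr (- N / (exp 1)\<^sup>2)"
proof -
  define w where "w = ln (1 + 1 / B)"
  have w: "w > 0" using assms unfolding w_def by (intro ln_gt_zero) simp
  have p: "p \<ge> 1" "\<delta> + 1 \<le> real p" using assms by (simp_all add: p_def) linarith+
  have r: "1 \<le> rho (1 / B)" "rho (1 / B) \<le> (1 + 1 / B)\<^sup>2" using rho_le[of "1 / B"] assms by auto
  have "ln (rho (1 / B)) \<le> ln ((1 + 1 / B)\<^sup>2)" using r by (subst ln_le_cancel_iff) auto
  also have "\<dots> = 2 * w" using assms by (subst ln_realpow) (auto simp: w_def add_pos_pos)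
  finally have lr: "ln (rho (1 / B)) \<le> 2 * w" .
  have "exp (1::real) \<ge> 1 + 1 + 1\<^sup>2 / 2" by (rule exp_lower_Taylor_quadratic) simp
  then have "(exp (1::real))\<^sup>2 \<ge> (5/2)\<^sup>2" by (intro power_mono) auto
  then have e: "(exp (1::real))\<^sup>2 \<ge> 5" by (simp add: power2_eq_square)
  \<comment> \<open>Since \<open>L \<ge> 1\<close>,
    \<open>N \<le> L + 1 \<le> 2 * L\<close>.\<close>
  have "N / (exp 1)\<^sup>2 \<le> (2 * real L) / 5" using e assms by (intro frac_le) auto
  then have "N / (exp 1)\<^sup>2 * ln (rho (1 / B)) \<le> (2 * real L) / 5 * (2 * w)"
    using lr r assms by (intro mult_mono) auto
  then have rate: "exp (- (4 * real L * w / 5)) \<le> rho (1 / B) powr (- N / (exp 1)\<^sup>2)"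
    using r by (simp add: powr_def)
  have "(real L + 1) powr \<delta> * (real L + 1) = (real L + 1) powr (\<delta> + 1)" by (simp add: powr_add)
  also have "\<dots> \<le> (real L + 1) powr real p" using p by (intro powr_mono) auto
  also have "\<dots> = (real L + 1) ^ p" by (simp add: powr_realpow)
  also have "\<dots> \<le> (2 * real L) ^ p" using assms by (intro power_mono) auto
  \<comment> \<open>The split is chosen so that \<open>power_le_exp\<close> at
    \<open>L * w / 5\<close> costs exactly the spare fifth of the exponent.\<close>
  also have "\<dots> = (10 / w) ^ p * (real L * w / 5) ^ p" using w by (simp only: power_mult_distrib[symmetric]) simp
  also have "\<dots> \<le> (10 / w) ^ p * (real p ^ p * exp (real L * w / 5))"
    using w p by (intro mult_left_mono power_le_exp) auto
  also have "\<dots> = (10 * real p / w) ^ p * exp (real L * w / 5)"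
    by (simp add: power_mult_distrib power_divide)
  finally have "(real L + 1) powr \<delta> * (real L + 1) * exp (- (real L * w)) \<le>
      (10 * real p / w) ^ p * exp (real L * w / 5) * exp (- (real L * w))"
    by (intro mult_right_mono) auto
  also have "\<dots> = (10 * real p / w) ^ p * exp (- (4 * real L * w / 5))"
    by (simp add: mult.assoc exp_add[symmetric])
  also have "\<dots> \<le> (10 * real p / w) ^ p * rho (1 / B) powr (- N / (exp 1)\<^sup>2)"
    using w by (intro mult_left_mono rate) auto
  also have "exp (- (real L * w)) = (1 + 1 / B) powr (- real L)"
    using add_pos_pos[of 1 "1 / B"] assms by (simp add: powr_def w_def)
  finally show ?thesis by (simp add: w_def mult.assoc)
qed

theorem theorem2p3:
  fixes \<delta> :: real
  assumes "\<delta> \<ge> 1"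
  shows "\<exists>C :: real \<Rightarrow> real.
    (\<forall>B>0. C B > 0) \<and> mono_on {0<..} C \<and>
    (\<forall>a b C\<^sub>G A :: real. \<forall>f :: real \<Rightarrow> real. \<forall>m :: nat.
       a < b \<longrightarrow> C\<^sub>G > 0 \<longrightarrow> A > 0 \<longrightarrow> f \<in> gevrey \<delta> a b C\<^sub>G A \<longrightarrow> m \<ge> 3 \<longrightarrow>
       (let B = A * (b - a) / 2 in
        \<exists>q. is_arg_min (\<lambda>p. maxnorm a b (\<lambda>x. f x - poly p x)) (\<lambda>p. p \<in> polys m) q \<and>
            maxnorm a b (\<lambda>x. f x - poly q x)
              \<le> C B * C\<^sub>G * rho (1 / B) powr (- (real m powr (1 / \<delta>)) / (exp 1)\<^sup>2)))"
proof -
  define p where "p = nat \<lceil>\<delta> + 1\<rceil>"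
  have p: "p \<ge> 1" using assms by (simp add: p_def) linarith
  \<comment> \<open>The product of the prefactor \<open>2 * (1 + B)\<close> from
    \<open>gevrey_approx\<close> and the constant of \<open>rate_bound\<close>. It increases with
    \<open>B\<close> because \<open>ln (1 + 1 / B)\<close> decreases.\<close>
  define C where "C = (\<lambda>B. 2 * (1 + B) * (10 * real p / ln (1 + 1 / B)) ^ p)"
  have ln_pos: "ln (1 + 1 / B) > 0" if "B > 0" for B :: real
    using that by (intro ln_gt_zero) simp
  have C_pos: "C B > 0" if "B > 0" for B
    using that p ln_pos[OF that] by (simp add: C_def)
  have C_mono: "mono_on {0<..} C"
  proof (rule mono_onI)
    fix B B' :: real assume B: "B \<in> {0<..}" "B' \<in> {0<..}" "B \<le> B'"
    have "ln (1 + 1 / B') \<le> ln (1 + 1 / B)"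
      using B by (subst ln_le_cancel_iff) (auto intro!: add_pos_pos divide_left_mono)
    then show "C B \<le> C B'"
      unfolding C_def using B ln_pos by (intro mult_mono power_mono divide_left_mono) auto
  qed
  have main: "\<exists>q. is_arg_min (\<lambda>p. maxnorm a b (\<lambda>x. f x - poly p x)) (\<lambda>p. p \<in> polys m) q \<and>
            maxnorm a b (\<lambda>x. f x - poly q x)
              \<le> C B * C\<^sub>G * rho (1 / B) powr (- (real m powr (1 / \<delta>)) / (exp 1)\<^sup>2)"
    if h: "a < b" "C\<^sub>G > 0" "A > 0" "f \<in> gevrey \<delta> a b C\<^sub>G A" "m \<ge> 3" and B_def: "B = A * (b - a) / 2"
    for a b C\<^sub>G A B :: real and f :: "real \<Rightarrow> real" and m :: nat
  proof -
    define N where "N = real m powr (1 / \<delta>)"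
    \<comment> \<open>The largest natural number with \<open>L powr \<delta> \<le> m\<close>, as
      \<open>gevrey_approx\<close> requires.\<close>
    define L where "L = nat \<lfloor>N\<rfloor>"
    have B: "B > 0" using h by (simp add: B_def)
    have N: "N \<ge> 1" using h assms by (simp add: N_def ge_one_powr_ge_zero)
    have L: "L \<ge> 1" "real L \<le> N" "N \<le> real L + 1" using N by (auto simp: L_def) linarith+
    have "real L powr \<delta> \<le> N powr \<delta>" using L assms by (intro powr_mono2) auto
    also have "\<dots> = real m" using h assms by (simp add: N_def powr_powr)
    finally have Lm: "real L powr \<delta> \<le> real m" .
    obtain j where j: "j \<le> L" "B ^ j / real (L choose j) \<le> (real L + 1) * (1 + 1 / B) powr (- real L)"
      using ex_binomial_average[OF B] by blast
    have "smooth_on_Icc a b f" using h by (simp add: gevrey_def)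
    then have "f differentiable_on {a..b}" unfolding smooth_on_Icc_def by (metis deriv_within.simps(1))
    then have "continuous_on {a..b} f" by (rule differentiable_imp_continuous_on)
    then obtain q where q: "is_arg_min (\<lambda>p. maxnorm a b (\<lambda>x. f x - poly p x)) (\<lambda>p. p \<in> polys m) q"
      using ex_best_approx h(1) by blast
    have "maxnorm a b (\<lambda>x. f x - poly q x)
        \<le> 2 * C\<^sub>G * (1 + B) * (real L + 1) powr \<delta> * (B ^ j / real (L choose j))"
    \<comment> \<open>The approximant from \<open>gevrey_approx\<close> varies with
      \<open>\<epsilon>\<close>, but the best approximant \<open>q\<close> does not, so
      \<open>\<epsilon>\<close> can be removed.\<close>
    proof (rule field_le_epsilon)
      fix \<epsilon> :: real assume "\<epsilon> > 0"
      then obtain r where r: "r \<in> polys m" "\<And>x. x \<in> {a..b} \<Longrightarrow> \<bar>f x - poly r x\<bar> \<le> 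
          2 * C\<^sub>G * (1 + B) * (real L + 1) powr \<delta> * (B ^ j / real (L choose j)) + \<epsilon>"
        using gevrey_approx[OF h(4) assms h(1-3) Lm j(1)] B_def by metis
      have "maxnorm a b (\<lambda>x. f x - poly q x) \<le> maxnorm a b (\<lambda>x. f x - poly r x)"
        using q r(1) by (auto simp: is_arg_min_def not_less)
      also have "\<dots> \<le> 2 * C\<^sub>G * (1 + B) * (real L + 1) powr \<delta> * (B ^ j / real (L choose j)) + \<epsilon>"
        using h r(2) by (intro maxnorm_le) auto
      finally show "maxnorm a b (\<lambda>x. f x - poly q x)
        \<le> 2 * C\<^sub>G * (1 + B) * (real L + 1) powr \<delta> * (B ^ j / real (L choose j)) + \<epsilon>" .
    qed
    also have "\<dots> \<le> 2 * C\<^sub>G * (1 + B) * (real L + 1) powr \<delta> * ((real L + 1) * (1 + 1 / B) powr (- real L))"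
      using h B j(2) by (intro mult_left_mono) auto
    also have "\<dots> = 2 * C\<^sub>G * (1 + B) * ((real L + 1) powr \<delta> * ((real L + 1) * (1 + 1 / B) powr (- real L)))"
      by (simp only: mult.assoc)
    also have "\<dots> \<le> 2 * C\<^sub>G * (1 + B) * ((10 * real p / ln (1 + 1 / B)) ^ p * rho (1 / B) powr (- N / (exp 1)\<^sup>2))"
      using h B N L assms unfolding p_def by (intro mult_left_mono rate_bound) auto
    finally have "maxnorm a b (\<lambda>x. f x - poly q x) \<le> C B * C\<^sub>G * rho (1 / B) powr (- N / (exp 1)\<^sup>2)"
      by (simp add: C_def mult_ac)
    then show ?thesis using q unfolding N_def by blast
  qed
  show ?thesis
    unfolding Let_def using C_pos C_mono
    by (intro exI[of _ C] conjI allI impI main[OF _ _ _ _ _ refl]) auto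
qed

end
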